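(* Let $p,q\ge1$ and let $\hat a(z)=z^p+a_1z^{p-1}+\cdots+a_p$, $\hat c(z)=z^q+c_1z^{q-1}+\cdots+c_q$ be real polynomials all of whose zeros lie inside the open unit disc, with reciprocal polynomials $a(z)=1+a_1z+\cdots+a_pz^p$ and $c(z)=1+c_1z+\cdots+c_qz^q$. Let $\varepsilon$ be a white noise sequence and let $\xi=\dot\varepsilon^\top$ be the $\mathbb{R}^{p+q}$-valued process defined in the context. Then $\xi$ can be realized by the following stable and controllable system: $$Z_{t+1}=GZ_t+e\,\varepsilon_t,\qquad \xi_t=CZ_t,$$ where $G=J-e g^\top$ is $(p+q)\times(p+q)$, $e$ is the first standard basis vector of $\mathbb{R}^{p+q}$, and $C=R(c,-a)$. This system is observable if and only if the polynomials $a$ and $c$ have no common zeros.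
   Context: $a(z)=z^p\hat a(z^{-1})$ and $c(z)=z^q\hat c(z^{-1})$. The $a_j$, $c_l$ are the parameters of the stationary, causal and invertible ARMA$(p,q)$ process $y$ with $a(L)y=c(L)\varepsilon$, $L$ the lag operator. The derivatives of $\varepsilon_t$ with respect to the parameters are $\varepsilon^{a_j}_t=\frac1{a(L)}\varepsilon_{t-j}$ ($1\le j\le p$) and $\varepsilon^{c_l}_t=-\frac1{c(L)}\varepsilon_{t-l}$ ($1\le l\le q$), where $1/a(L)$, $1/c(L)$ are the power series expansions in $L$; $\dot\varepsilon_t$ is the row vector $(\varepsilon^{a_1}_t,\dots,\varepsilon^{a_p}_t,\varepsilon^{c_1}_t,\dots,\varepsilon^{c_q}_t)$. The transfer function from $\varepsilon$ to $\xi$ (replace $L$ by $z^{-1}$) is $$\tau(z)=\begin{pmatrix}\frac1{\hat a(z)}u_p^*(z)\\-\frac1{\hat c(z)}u_q^*(z)\end{pmatrix},\qquad u_k^*(z)=(z^{k-1},\dots,z,1)^\top,$$ and a linear system $Z_{t+1}=AZ_t+b\varepsilon_t$, $\xi_t=CZ_t$ realizes $\xi$ if its transfer function $C(zI-A)^{-1}b$ equals $\tau(z)$. The system is stable if all eigenvalues of $A$ lie in the open unit disc; controllability and observability have the usual meaning (full rank of the controllability, resp. observability, matrix). $J$ is the shift matrix, $J_{ij}=1$ if $i=j+1$ and $0$ otherwise. $g=(g_1,\dots,g_{p+q})^\top$ where $\hat a(z)\hat c(z)=z^{p+q}+\sum_{i=1}^{p+q}g_iz^{p+q-i}$. $R(c,-a)$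 is the $(p+q)\times(p+q)$ Sylvester matrix $\begin{pmatrix}R_p(c)\\-R_q(a)\end{pmatrix}$, where $R_p(c)$ is the $p\times(p+q)$ matrix whose $i$-th row is $(0,\dots,0,1,c_1,\dots,c_q,0,\dots,0)$ with $i-1$ leading zeros, and $R_q(a)$ is the $q\times(p+q)$ matrix whose $i$-th row is $(0,\dots,0,1,a_1,\dots,a_p,0,\dots,0)$ with $i-1$ leading zeros.
   Formalization: The observability equivalence is stated only when a_p ≠ 0 or c_q ≠ 0; without this it fails, e.g. p=q=1, a_1=c_1=0, where a=c=1 have no common zeros but the system is not observable. *)

theory Defs
  imports
    "HOL-Probability.Probability_Measure"
    "HOL-Computational_Algebra.Polynomial_FPS"
    "Jordan_Normal_Form.Char_Poly"
    "Jordan_Normal_Form.Gauss_Jordan_Elimination"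
    "Jordan_Normal_Form.DL_Rank"
begin

unbundle no vec_syntax

section \<open>Polynomials given by their parameters\<close>

text \<open>Parameters are functions on \<open>nat\<close>, of which only the values at \<open>1, \<dots>, k\<close> are used:
  \<open>hat_poly k a = z^k + a\<^sub>1 z^(k-1) + \<dots> + a\<^sub>k\<close> and
  \<open>lag_poly k a = 1 + a\<^sub>1 z + \<dots> + a\<^sub>k z^k\<close>.\<close>

definition hat_poly :: "nat \<Rightarrow> (nat \<Rightarrow> real) \<Rightarrow> real poly" where
  "hat_poly k a = monom 1 k + (\<Sum>i=1..k. monom (a i) (k - i))"

definition lag_poly :: "nat \<Rightarrow> (nat \<Rightarrow> real) \<Rightarrow> real poly" where
  "lag_poly k a = 1 + (\<Sum>i=1..k. monom (a i) i)"

definition cpoly :: "real poly \<Rightarrow> complex \<Rightarrow> complex" where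
  "cpoly f z = poly (map_poly complex_of_real f) z"

section \<open>White noise and the derivative process\<close>

definition white_noise :: "'w measure \<Rightarrow> (int \<Rightarrow> 'w \<Rightarrow> real) \<Rightarrow> bool" where
  "white_noise M \<epsilon> \<longleftrightarrow> prob_space M \<and>
     (\<forall>t. \<epsilon> t \<in> borel_measurable M \<and> integrable M (\<lambda>\<omega>. (\<epsilon> t \<omega>)\<^sup>2) \<and>
          integral\<^sup>L M (\<epsilon> t) = 0) \<and>
     (\<exists>v>0. \<forall>s t. integral\<^sup>L M (\<lambda>\<omega>. \<epsilon> s \<omega> * \<epsilon> t \<omega>) = (if s = t then v else 0))"

text \<open>\<open>lag_filter \<psi> \<epsilon>\<close> is \<open>\<psi>(L) \<epsilon>\<close>.  For absolutely summable coefficients and white noise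
  the series converges absolutely almost surely; elsewhere its value is irrelevant.\<close>

definition lag_filter :: "real fps \<Rightarrow> (int \<Rightarrow> 'w \<Rightarrow> real) \<Rightarrow> int \<Rightarrow> 'w \<Rightarrow> real" where
  "lag_filter \<psi> \<epsilon> t \<omega> = (\<Sum>k. fps_nth \<psi> k * \<epsilon> (t - int k) \<omega>)"

definition eps_a :: "nat \<Rightarrow> (nat \<Rightarrow> real) \<Rightarrow> (int \<Rightarrow> 'w \<Rightarrow> real) \<Rightarrow> nat \<Rightarrow> int \<Rightarrow> 'w \<Rightarrow> real" where
  "eps_a p a \<epsilon> j t = lag_filter (inverse (fps_of_poly (lag_poly p a))) \<epsilon> (t - int j)"

definition eps_c :: "nat \<Rightarrow> (nat \<Rightarrow> real) \<Rightarrow> (int \<Rightarrow> 'w \<Rightarrow> real) \<Rightarrow> nat \<Rightarrow> int \<Rightarrow> 'w \<Rightarrow> real" where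
  "eps_c q c \<epsilon> l t \<omega> = - lag_filter (inverse (fps_of_poly (lag_poly q c))) \<epsilon> (t - int l) \<omega>"

definition xi_process ::
  "nat \<Rightarrow> nat \<Rightarrow> (nat \<Rightarrow> real) \<Rightarrow> (nat \<Rightarrow> real) \<Rightarrow> (int \<Rightarrow> 'w \<Rightarrow> real) \<Rightarrow> int \<Rightarrow> 'w \<Rightarrow> real Matrix.vec" where
  "xi_process p q a c \<epsilon> t \<omega> =
     Matrix.vec p (\<lambda>i. eps_a p a \<epsilon> (i + 1) t \<omega>) @\<^sub>v Matrix.vec q (\<lambda>i. eps_c q c \<epsilon> (i + 1) t \<omega>)"

section \<open>Transfer functions and realizations\<close>

text \<open>\<open>T\<close> is the transfer function from \<open>\<epsilon>\<close> to the \<open>n\<close>-dimensional process \<open>\<xi>\<close>: one has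
  \<open>\<xi>\<^sub>t = \<Sum>k. h\<^sub>k \<epsilon>\<^sub>t\<^sub>-\<^sub>k\<close> with absolutely summable \<open>h\<close>, and \<open>T(z) = \<Sum>k. h\<^sub>k z^(-k)\<close>
  on \<open>cmod z \<ge> 1\<close>, which determines a rational \<open>T\<close>.\<close>

definition has_transfer_function ::
  "'w measure \<Rightarrow> nat \<Rightarrow> (int \<Rightarrow> 'w \<Rightarrow> real) \<Rightarrow> (int \<Rightarrow> 'w \<Rightarrow> real Matrix.vec) \<Rightarrow>
   (complex \<Rightarrow> complex Matrix.vec) \<Rightarrow> bool" where
  "has_transfer_function M n \<epsilon> \<xi> T \<longleftrightarrow>
     (\<forall>t \<omega>. \<xi> t \<omega> \<in> carrier_vec n) \<and> (\<forall>z. T z \<in> carrier_vec n) \<and>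
     (\<exists>h :: nat \<Rightarrow> real Matrix.vec. \<forall>i<n.
        summable (\<lambda>k. \<bar>h k $ i\<bar>) \<and>
        (\<forall>t. AE \<omega> in M. (\<lambda>k. h k $ i * \<epsilon> (t - int k) \<omega>) sums (\<xi> t \<omega> $ i)) \<and>
        (\<forall>z. cmod z \<ge> 1 \<longrightarrow> (\<lambda>k. complex_of_real (h k $ i) / z ^ k) sums (T z $ i)))"

definition ustar :: "nat \<Rightarrow> complex \<Rightarrow> complex Matrix.vec" where
  "ustar k z = Matrix.vec k (\<lambda>i. z ^ (k - 1 - i))"

definition tau :: "nat \<Rightarrow> nat \<Rightarrow> (nat \<Rightarrow> real) \<Rightarrow> (nat \<Rightarrow> real) \<Rightarrow> complex \<Rightarrow> complex Matrix.vec" where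
  "tau p q a c z =
     ((1 / cpoly (hat_poly p a) z) \<cdot>\<^sub>v ustar p z) @\<^sub>v ((- 1 / cpoly (hat_poly q c) z) \<cdot>\<^sub>v ustar q z)"

text \<open>\<open>C (z I - A)\<^sup>-\<^sup>1 b\<close>; meaningful only if \<open>z\<close> is not an eigenvalue of \<open>A\<close>, since
  \<open>mat_inverse\<close> returns \<open>None\<close> on singular matrices.\<close>

definition system_transfer ::
  "real mat \<Rightarrow> real Matrix.vec \<Rightarrow> real mat \<Rightarrow> complex \<Rightarrow> complex Matrix.vec" where
  "system_transfer A b C z =
     map_mat complex_of_real C *\<^sub>v
       (the (mat_inverse (z \<cdot>\<^sub>m 1\<^sub>m (dim_row A) - map_mat complex_of_real A)) *\<^sub>v
         map_vec complex_of_real b)"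

definition realizes ::
  "real mat \<Rightarrow> real Matrix.vec \<Rightarrow> real mat \<Rightarrow> (complex \<Rightarrow> complex Matrix.vec) \<Rightarrow> bool" where
  "realizes A b C T \<longleftrightarrow>
     (\<forall>z. \<not> eigenvalue (map_mat complex_of_real A) z \<longrightarrow> system_transfer A b C z = T z)"

definition stable_mat :: "real mat \<Rightarrow> bool" where
  "stable_mat A \<longleftrightarrow> (\<forall>z. eigenvalue (map_mat complex_of_real A) z \<longrightarrow> cmod z < 1)"

definition controllability_matrix :: "real mat \<Rightarrow> real Matrix.vec \<Rightarrow> real mat" where
  "controllability_matrix A b =
     mat_of_cols (dim_row A) (map (\<lambda>k. (A ^\<^sub>m k) *\<^sub>v b) [0..<dim_row A])"

definition observability_matrix :: "real mat \<Rightarrow> real mat \<Rightarrow> real mat" where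
  "observability_matrix A C =
     mat_of_rows (dim_row A) (concat (map (\<lambda>k. rows (C * (A ^\<^sub>m k))) [0..<dim_row A]))"

text \<open>The first argument of \<open>vec_space.rank\<close> is the number of rows.\<close>

definition controllable :: "real mat \<Rightarrow> real Matrix.vec \<Rightarrow> bool" where
  "controllable A b \<longleftrightarrow> vec_space.rank (dim_row A) (controllability_matrix A b) = dim_row A"

definition observable :: "real mat \<Rightarrow> real mat \<Rightarrow> bool" where
  "observable A C \<longleftrightarrow>
     vec_space.rank (dim_row (observability_matrix A C)) (observability_matrix A C) = dim_row A"

section \<open>The system matrices\<close>

definition shift_mat :: "nat \<Rightarrow> real mat" where
  "shift_mat n = Matrix.mat n n (\<lambda>(i, j). if i = j + 1 then 1 else 0)"

definition g_vec :: "nat \<Rightarrow> nat \<Rightarrow> (nat \<Rightarrow> real) \<Rightarrow> (nat \<Rightarrow> real) \<Rightarrow> real Matrix.vec" where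
  "g_vec p q a c =
     Matrix.vec (p + q) (\<lambda>i. poly.coeff (hat_poly p a * hat_poly q c) (p + q - (i + 1)))"

definition G_mat :: "nat \<Rightarrow> nat \<Rightarrow> (nat \<Rightarrow> real) \<Rightarrow> (nat \<Rightarrow> real) \<Rightarrow> real mat" where
  "G_mat p q a c = shift_mat (p + q) -
     mat_of_cols (p + q) [unit_vec (p + q) 0] * mat_of_rows (p + q) [g_vec p q a c]"

text \<open>Row \<open>i\<close> (counted from \<open>0\<close>) consists of \<open>i\<close> zeros followed by the coefficients of \<open>f\<close>
  in ascending order.\<close>

definition band_mat :: "nat \<Rightarrow> nat \<Rightarrow> real poly \<Rightarrow> real mat" where
  "band_mat m n f = Matrix.mat m n (\<lambda>(i, j). if i \<le> j then poly.coeff f (j - i) else 0)"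

definition R_mat :: "nat \<Rightarrow> nat \<Rightarrow> (nat \<Rightarrow> real) \<Rightarrow> (nat \<Rightarrow> real) \<Rightarrow> real mat" where
  "R_mat p q a c =
     band_mat p (p + q) (lag_poly q c) @\<^sub>r (- band_mat q (p + q) (lag_poly p a))"

end

theory Submission
  imports
    Defs
    "Subresultants.Subresultant_Gcd"
    "HOL-Complex_Analysis.Complex_Analysis"
    "HOL-Computational_Algebra.Field_as_Ring"
begin

text \<open>Write \<open>a'\<close> and \<open>c'\<close> for the polynomials \<open>hat_poly p a\<close> and \<open>hat_poly q c\<close>.  The matrix \<open>G\<close> is
  the companion matrix of \<open>h = a' c'\<close>, and for \<open>w(z) = (z^(n-1), \<dots>, z, 1)\<close> one has
  \<open>(z I - G) w(z) = h(z) e\<close>.  This gives at once the eigenvalues of \<open>G\<close>, the resolvent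
  \<open>(z I - G)\<^sup>-\<^sup>1 e = w(z) / h(z)\<close>, and, as \<open>R(c,-a) w(z)\<close> has the blocks \<open>c'(z) u\<^sub>p\<^sup>*(z)\<close> and
  \<open>-a'(z) u\<^sub>q\<^sup>*(z)\<close>, the transfer function.  A common root \<open>z\<close> of \<open>a'\<close> and \<open>c'\<close> makes \<open>w(z)\<close> an
  eigenvector of \<open>G\<close> killed by \<open>C\<close>, so the system is not observable.  Without a common root \<open>C\<close>
  itself is nonsingular, since up to signs of rows it is the Sylvester matrix of \<open>c'\<close> and \<open>a'\<close>.

  As \<open>a\<close> and \<open>c\<close> have no zeros in the closed unit disc, the expansions of \<open>1/a\<close> and \<open>1/c\<close> converge
  on a larger disc, so their coefficients are absolutely summable; since \<open>E|\<epsilon>\<^sub>t|\<close> is bounded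
  uniformly in \<open>t\<close>, the filtered series converge absolutely almost surely.\<close>

unbundle no vec_syntax

section \<open>The polynomials and their reciprocals\<close>

lemma coeff_lag_poly:
  "poly.coeff (lag_poly k a) i = (if i = 0 then 1 else if i \<le> k then a i else 0)"
  by (auto simp: lag_poly_def coeff_sum)

lemma coeff_hat_poly:
  "poly.coeff (hat_poly k a) i = (if i = k then 1 else if i < k then a (k - i) else 0)"
proof -
  have "(\<Sum>j=1..k. poly.coeff (monom (a j) (k - j)) i)
      = (\<Sum>j=1..k. if j = k - i then (if i < k then a j else 0) else 0)"
    by (intro sum.cong) auto
  then show ?thesis
    by (auto simp: hat_poly_def coeff_sum)
qed

lemma degree_hat_poly [simp]: "degree (hat_poly k a) = k"
  by (rule antisym[OF degree_le le_degree]) (auto simp: coeff_hat_poly)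

lemma lead_coeff_hat_poly: "poly.coeff (hat_poly k a) k = 1"
  by (simp add: coeff_hat_poly)

lemma hat_poly_nonzero [simp]: "hat_poly k a \<noteq> 0"
  using lead_coeff_hat_poly[of k a] by auto

lemma reflect_hat_poly: "reflect_poly (hat_poly k a) = lag_poly k a"
  by (rule poly_eqI) (auto simp: coeff_reflect_poly coeff_hat_poly coeff_lag_poly)

lemma cpoly_hat_conv_lag:
  assumes "z \<noteq> 0"
  shows "cpoly (hat_poly k a) z = z ^ k * cpoly (lag_poly k a) (1 / z)"
proof -
  have "map_poly complex_of_real (lag_poly k a)
      = reflect_poly (map_poly complex_of_real (hat_poly k a))"
    by (rule poly_eqI) (auto simp: reflect_hat_poly[symmetric] coeff_reflect_poly coeff_map_poly)
  then show ?thesis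
    using assms by (simp add: cpoly_def poly_reflect_poly_nz inverse_eq_divide field_simps)
qed

lemma cpoly_hat_sum:
  "cpoly (hat_poly k a) z
    = (\<Sum>l\<le>k. complex_of_real (poly.coeff (lag_poly k a) l) * z ^ (k - l))"
proof -
  have "cpoly (hat_poly k a) z
      = (\<Sum>l\<in>{0..k}. complex_of_real (poly.coeff (hat_poly k a) l) * z ^ l)"
    by (simp add: cpoly_def poly_altdef coeff_map_poly atLeast0AtMost)
  also have "\<dots> = (\<Sum>l\<in>{0..k}. complex_of_real (poly.coeff (hat_poly k a) (k - l)) * z ^ (k - l))"
    by (subst sum.atLeastAtMost_rev) simp
  also have "\<dots> = (\<Sum>l\<le>k. complex_of_real (poly.coeff (lag_poly k a) l) * z ^ (k - l))"
    by (rule sum.cong) (auto simp: coeff_hat_poly coeff_lag_poly)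
  finally show ?thesis .
qed

interpretation map_poly_of_real: map_poly_inj_idom_hom "of_real :: real \<Rightarrow> complex" ..

lemma degree_map_poly_of_real: "degree (map_poly complex_of_real f) = degree f"
  by simp

lemma cpoly_mult: "cpoly (f * g) z = cpoly f z * cpoly g z"
  by (simp add: cpoly_def map_poly_of_real.hom_mult)

section \<open>Companion matrices\<close>

text \<open>The form with the coefficients in the top row and ones below the diagonal, as in
  \<open>J - e g^T\<close>; it is the companion matrix of \<open>h\<close> for monic
  \<open>h\<close>. The field is arbitrary because controllability concerns the real matrix and
  eigenvalues the complex one.\<close>

definition companion_mat :: "'a::field poly \<Rightarrow> 'a mat" where
  "companion_mat h = Matrix.mat (degree h) (degree h) (\<lambda>(i, j).
     (if i = j + 1 then 1 else 0) - (if i = 0 then poly.coeff h (degree h - 1 - j) else 0))"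

text \<open>The vector \<open>ustar\<close> over an arbitrary field.\<close>

definition power_vec :: "nat \<Rightarrow> 'a::field \<Rightarrow> 'a Matrix.vec" where
  "power_vec n z = Matrix.vec n (\<lambda>i. z ^ (n - 1 - i))"

lemma companion_mat_carrier [simp]: "companion_mat h \<in> carrier_mat (degree h) (degree h)"
  by (simp add: companion_mat_def)

lemma companion_mat_dim [simp]:
  "dim_row (companion_mat h) = degree h" "dim_col (companion_mat h) = degree h"
  by (simp_all add: companion_mat_def)

lemma power_vec_carrier [simp]: "power_vec n z \<in> carrier_vec n"
  by (simp add: power_vec_def)

lemma power_vec_dim [simp]: "dim_vec (power_vec n z) = n"
  by (simp add: power_vec_def)

lemma companion_mult_index:
  assumes "v \<in> carrier_vec (degree h)" and "i < degree h"
  shows "(companion_mat h *\<^sub>v v) $ i = (if i = 0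
    then - (\<Sum>j<degree h. poly.coeff h (degree h - 1 - j) * v $ j) else v $ (i - 1))"
proof (cases "i = 0")
  case True
  then show ?thesis
    using assms by (auto simp: companion_mat_def scalar_prod_def lessThan_atLeast0 sum_negf)
next
  case False
  have "(companion_mat h *\<^sub>v v) $ i = (\<Sum>j=0..<degree h. (if i = Suc j then 1 else 0) * v $ j)"
    using assms False by (simp add: companion_mat_def scalar_prod_def)
  also have "\<dots> = (\<Sum>j=0..<degree h. if j = i - 1 then v $ j else 0)"
    by (rule sum.cong) (use False in auto)
  finally have "(companion_mat h *\<^sub>v v) $ i = (\<Sum>j=0..<degree h. if j = i - 1 then v $ j else 0)" .
  then show ?thesis
    using assms False by simp
qed

text \<open>This sum is what the top row of the companion matrix produces, up to sign, on
  \<open>power_vec\<close>.\<close>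

lemma monic_poly_sum:
  fixes h :: "'a::field poly"
  assumes "lead_coeff h = 1"
  shows "(\<Sum>j<degree h. poly.coeff h (degree h - 1 - j) * z ^ (degree h - 1 - j))
    = poly h z - z ^ degree h"
proof -
  have "poly h z = (\<Sum>j<degree h. poly.coeff h j * z ^ j) + z ^ degree h"
    using assms by (simp add: poly_altdef lessThan_Suc_atMost[symmetric])
  then show ?thesis
    using sum.nat_diff_reindex[of "\<lambda>j. poly.coeff h j * z ^ j" "degree h"] by simp
qed

text \<open>The rows below the first shift the entries down, which on descending powers is
  multiplication by \<open>z\<close>. Only the top row deviates: it gives \<open>z^n - h(z)\<close>
  in place of \<open>z^n\<close>.\<close>

lemma companion_mult_power_vec:
  fixes h :: "'a::field poly"
  assumes "lead_coeff h = 1" and "degree h > 0"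
  shows "companion_mat h *\<^sub>v power_vec (degree h) z
    = z \<cdot>\<^sub>v power_vec (degree h) z - poly h z \<cdot>\<^sub>v unit_vec (degree h) 0"
proof (rule eq_vecI)
  fix i assume "i < dim_vec (z \<cdot>\<^sub>v power_vec (degree h) z - poly h z \<cdot>\<^sub>v unit_vec (degree h) 0)"
  then have i: "i < degree h" by simp
  show "(companion_mat h *\<^sub>v power_vec (degree h) z) $ i
      = (z \<cdot>\<^sub>v power_vec (degree h) z - poly h z \<cdot>\<^sub>v unit_vec (degree h) 0) $ i"
  proof (cases "i = 0")
    case True
    have "z * z ^ (degree h - 1) = z ^ degree h"
      using assms(2) by (simp flip: power_Suc)
    then show ?thesis
      using True i monic_poly_sum[OF assms(1), of z]
      by (simp add: companion_mult_index power_vec_def del: index_mult_mat_vec)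
  next
    case False
    then obtain j where j: "i = Suc j"
      using not0_implies_Suc by blast
    then have "degree h - Suc j = Suc (degree h - Suc (Suc j))"
      using i by auto
    then show ?thesis
      using j i by (simp add: companion_mult_index power_vec_def del: index_mult_mat_vec)
  qed
qed simp

lemma power_vec_nonzero:
  assumes "n > 0"
  shows "power_vec n z \<noteq> (0\<^sub>v n :: 'a::field Matrix.vec)"
proof
  assume "power_vec n z = (0\<^sub>v n :: 'a Matrix.vec)"
  \<comment> \<open>The last entry is \<open>z ^ 0 = 1\<close>, whatever \<open>z\<close>
    is.\<close>
  then have "power_vec n z $ (n - 1) = (0\<^sub>v n :: 'a Matrix.vec) $ (n - 1)"
    by simp
  then show False
    using assms by (simp add: power_vec_def)
qed

lemma companion_eigenvector:
  assumes "lead_coeff h = 1" and "degree h > 0" and "poly h z = 0"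
  shows "eigenvector (companion_mat h) (power_vec (degree h) z) z"
  using assms power_vec_nonzero[of "degree h" z]
  by (auto simp: eigenvector_def companion_mult_power_vec)

text \<open>The lower rows of the eigenvector equation force every eigenvector to be a nonzero
  multiple of \<open>power_vec\<close>; the top row then says that \<open>h\<close> vanishes at
  \<open>z\<close>.\<close>

lemma eigenvalue_companion:
  fixes h :: "'a::field poly"
  assumes "lead_coeff h = 1" and "degree h > 0"
  shows "eigenvalue (companion_mat h) z \<longleftrightarrow> poly h z = 0"
proof
  assume "poly h z = 0"
  then show "eigenvalue (companion_mat h) z"
    using companion_eigenvector[OF assms] by (auto simp: eigenvalue_def)
next
  let ?n = "degree h"
  assume "eigenvalue (companion_mat h) z"
  then obtain v where v: "v \<in> carrier_vec ?n" "v \<noteq> 0\<^sub>v ?n"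
      and eq: "companion_mat h *\<^sub>v v = z \<cdot>\<^sub>v v"
    by (auto simp: eigenvalue_def eigenvector_def)
  have idx: "(companion_mat h *\<^sub>v v) $ i = z * v $ i" if "i < ?n" for i
    using that v eq by simp
  \<comment> \<open>Row \<open>i > 0\<close> reads \<open>v $ (i - 1) = z * v $ i\<close>, so all
    entries follow from the last one, going upwards.\<close>
  have last: "v $ (?n - 1 - k) = v $ (?n - 1) * z ^ k" if "k < ?n" for k
    using that
  proof (induction k)
    case (Suc k)
    have "v $ (?n - 1 - Suc k) = z * v $ (?n - 1 - k)"
      using idx[of "?n - 1 - k"] Suc.prems v
      by (simp add: companion_mult_index del: index_mult_mat_vec)
    then show ?case
      using Suc by simp
  qed simp
  have v_eq: "v = v $ (?n - 1) \<cdot>\<^sub>v power_vec ?n z"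
  proof (rule eq_vecI)
    fix i assume "i < dim_vec (v $ (?n - 1) \<cdot>\<^sub>v power_vec ?n z)"
    then show "v $ i = (v $ (?n - 1) \<cdot>\<^sub>v power_vec ?n z) $ i"
      using last[of "?n - 1 - i"] by (simp add: power_vec_def)
  qed (use v in simp)
  have "v $ (?n - 1) \<noteq> 0"
  proof
    assume "v $ (?n - 1) = 0"
    with v_eq have "v = 0 \<cdot>\<^sub>v power_vec ?n z"
      by metis
    also have "\<dots> = 0\<^sub>v ?n"
      by (rule eq_vecI) simp_all
    finally show False
      using v by simp
  qed
  have "(companion_mat h *\<^sub>v v) $ 0 = v $ (?n - 1) * (companion_mat h *\<^sub>v power_vec ?n z) $ 0"
    by (subst v_eq, subst mult_mat_vec[OF companion_mat_carrier power_vec_carrier])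
       (use assms in simp)
  also have "\<dots> = v $ (?n - 1) * (z * power_vec ?n z $ 0 - poly h z)"
    using assms by (simp add: companion_mult_power_vec)
  finally have "v $ (?n - 1) * poly h z = v $ (?n - 1) * z * power_vec ?n z $ 0 - z * v $ 0"
    using idx[of 0] assms by (simp add: algebra_simps)
  also have "v $ 0 = v $ (?n - 1) * power_vec ?n z $ 0"
    using assms by (subst (1) v_eq) simp
  finally show "poly h z = 0"
    using \<open>v $ (?n - 1) \<noteq> 0\<close> by simp
qed

text \<open>Since \<open>z\<close> is not an eigenvalue, the inverse exists, and it suffices to
  check that the right-hand side is mapped to the first unit vector.\<close>

lemma companion_resolvent:
  fixes h :: "'a::field poly"
  assumes "lead_coeff h = 1" and "degree h > 0" and "poly h z \<noteq> 0"
  shows "the (mat_inverse (z \<cdot>\<^sub>m 1\<^sub>m (degree h) - companion_mat h)) *\<^sub>v unit_vec (degree h) 0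
    = (1 / poly h z) \<cdot>\<^sub>v power_vec (degree h) z"
proof -
  let ?n = "degree h" and ?A = "z \<cdot>\<^sub>m 1\<^sub>m (degree h) - companion_mat h"
  let ?w = "(1 / poly h z) \<cdot>\<^sub>v power_vec (degree h) z"
  have A: "?A \<in> carrier_mat ?n ?n"
    by (intro minus_carrier_mat) simp
  \<comment> \<open>\<open>char_matrix\<close> has the opposite sign convention
    \<open>A - z I\<close>.\<close>
  have "char_matrix (companion_mat h) z = (-1) \<cdot>\<^sub>m ?A"
    by (rule eq_matI) (auto simp: char_matrix_def)
  then have "det (char_matrix (companion_mat h) z) = (-1) ^ ?n * det ?A"
    by simp
  then have "det ?A \<noteq> 0"
    using eigenvalue_det[OF companion_mat_carrier, of h z] eigenvalue_companion[OF assms(1,2), of z]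
      assms(3) by auto
  then have "?A \<in> Units (ring_mat TYPE('a) ?n ())"
    by (rule det_non_zero_imp_unit[OF A])
  \<comment> \<open>From here on, \<open>the\<close> is applied to a genuine inverse and not to
    \<open>None\<close>.\<close>
  then obtain B where B: "mat_inverse ?A = Some B"
    using mat_inverse(1)[OF A, where b = "()"] by blast
  then have BA: "B * ?A = 1\<^sub>m ?n" "B \<in> carrier_mat ?n ?n"
    using mat_inverse(2)[OF A] by auto
  have "?A *\<^sub>v ?w = unit_vec ?n 0"
  proof -
    have "?A *\<^sub>v power_vec ?n z = poly h z \<cdot>\<^sub>v unit_vec ?n 0"
    proof -
      have "?A *\<^sub>v power_vec ?n z = (z \<cdot>\<^sub>m 1\<^sub>m ?n) *\<^sub>v power_vec ?n z - companion_mat h *\<^sub>v power_vec ?n z"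
        by (rule minus_mult_distrib_mat_vec) auto
      also have "(z \<cdot>\<^sub>m 1\<^sub>m ?n) *\<^sub>v power_vec ?n z = z \<cdot>\<^sub>v power_vec ?n z"
        by (rule eq_vecI) simp_all
      finally show ?thesis
        unfolding companion_mult_power_vec[OF assms(1,2)] by auto
    qed
    then show ?thesis
      using assms(3) by (subst mult_mat_vec[OF A power_vec_carrier]) (simp add: smult_smult_assoc)
  qed
  then have "B *\<^sub>v unit_vec ?n 0 = B *\<^sub>v (?A *\<^sub>v ?w)"
    by simp
  also have "\<dots> = ?w"
    using BA A by (simp flip: assoc_mult_mat_vec)
  finally show ?thesis
    by (simp add: B)
qed

section \<open>Controllability of companion matrices\<close>

lemma pow_mat_Suc_left:
  assumes "A \<in> carrier_mat n n"
  shows "A ^\<^sub>m Suc k = A * A ^\<^sub>m k"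
proof (induction k)
  case 0
  then show ?case using assms by simp
next
  case (Suc k)
  then show ?case
    using assms assoc_mult_mat[OF assms pow_carrier_mat[OF assms] assms, of k] by simp
qed

text \<open>Each multiplication moves the entries down by one place and computes a new entry only at
  the top. The leading one of the unit vector thus reaches place \<open>k\<close> with zeros below
  it; the entries above, excluded by \<open>k \<le> i\<close>, depend on \<open>h\<close>.\<close>

lemma companion_pow_unit_index:
  assumes "degree h > 0" and "k < degree h" and "i < degree h" and "k \<le> i"
  shows "((companion_mat h ^\<^sub>m k) *\<^sub>v unit_vec (degree h) 0) $ i = (if i = k then 1 else 0)"
  using assms
proof (induction k arbitrary: i)
  case 0
  then show ?case by simp
next
  case (Suc k)
  let ?n = "degree h" and ?A = "companion_mat h"
  have "(?A ^\<^sub>m Suc k) *\<^sub>v unit_vec ?n 0 = ?A *\<^sub>v ((?A ^\<^sub>m k) *\<^sub>v unit_vec ?n 0)"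
    \<comment> \<open>With the new factor on the left, the row description
      \<open>companion_mult_index\<close> applies to the previous vector.\<close>
    unfolding pow_mat_Suc_left[OF companion_mat_carrier]
    by (intro assoc_mult_mat_vec[of _ ?n ?n _ ?n] pow_carrier_mat) auto
  moreover have "(?A ^\<^sub>m k) *\<^sub>v unit_vec ?n 0 \<in> carrier_vec ?n"
    by (intro mult_mat_vec_carrier[of _ _ ?n] pow_carrier_mat) auto
  ultimately show ?case
    using Suc by (auto simp: companion_mult_index simp del: index_mult_mat_vec pow_mat.simps)
qed

text \<open>The controllability matrix is upper triangular with ones on the diagonal, so its
  determinant is 1.\<close>

lemma controllable_companion:
  assumes "degree h > 0"
  shows "controllable (companion_mat h) (unit_vec (degree h) 0)"
proof -
  let ?n = "degree h" and ?K = "controllability_matrix (companion_mat h) (unit_vec (degree h) 0)"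
  interpret vec_space "TYPE(real)" "degree h" .
  have K: "?K \<in> carrier_mat ?n ?n"
    by (auto simp: controllability_matrix_def intro!: carrier_matI)
  have ent: "?K $$ (i, k) = (if i = k then 1 else 0)" if "i < ?n" "k \<le> i" for i k
    using that assms companion_pow_unit_index[of h k i]
    by (simp add: controllability_matrix_def mat_of_cols_index del: index_mult_mat_vec)
  have "upper_triangular ?K"
    using ent K by (auto simp: upper_triangular_def)
  moreover have "diag_mat ?K = map (\<lambda>_. 1) [0..<?n]"
    using K ent by (auto simp: diag_mat_def)
  ultimately have "det ?K = 1"
    using det_upper_triangular[OF _ K] by (simp add: map_replicate_const)
  then show ?thesis
    using low_rank_det_zero[OF K] by (simp add: controllable_def)
qed

section \<open>Observability and kernels\<close>

text \<open>For distinct columns this is linear independence. The columns enter \<open>rank\<close>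
  as a set, so repeated columns are treated apart: then the rank is too small, and the difference of
  two unit vectors lies in the kernel.\<close>

lemma (in vec_space) full_rank_iff_trivial_kernel:
  assumes A: "A \<in> carrier_mat n nc"
  shows "rank A = nc \<longleftrightarrow> (\<forall>v\<in>carrier_vec nc. A *\<^sub>v v = 0\<^sub>v n \<longrightarrow> v = 0\<^sub>v nc)"
proof (cases "distinct (cols A)")
  case True
  show ?thesis
    using lin_indpt_full_rank[OF A True] full_rank_lin_indpt[OF A _ True] lin_depI[OF A _ _ _ True]
      lin_depE[OF A _ True] by metis
next
  case False
  then obtain i j where ij: "i < nc" "j < nc" "i \<noteq> j" "col A i = col A j"
    using A by (auto simp: distinct_conv_nth)
  \<comment> \<open>The rank is the size of a maximal independent set of columns, hence at most the
    number of different columns.\<close>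
  obtain S where S: "maximal S (\<lambda>T. T \<subseteq> set (cols A) \<and> lin_indpt T)"
    using maximal_exists[of "\<lambda>T. T \<subseteq> set (cols A) \<and> lin_indpt T" "card (set (cols A))" "{}"]
    by (meson List.finite_set card_mono empty_iff empty_subsetI finite_lin_indpt2 rev_finite_subset)
  have "rank A = card S"
    by (rule rank_card_indpt[OF A S])
  also have "\<dots> \<le> card (set (cols A))"
    using S by (auto simp: maximal_def intro!: card_mono)
  also have "\<dots> < nc"
    using False A by (metis card_distinct card_length carrier_matD(2) cols_length le_neq_implies_less)
  finally have "rank A \<noteq> nc" by simp
  moreover have "A *\<^sub>v (unit_vec nc i - unit_vec nc j) = 0\<^sub>v n"
  proof -
    have "A $$ (r, i) = A $$ (r, j)" if "r < n" for r
      using ij A that by (metis carrier_matD index_col)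
    then show ?thesis
      using A ij by (intro eq_vecI) (auto simp: mult_minus_distrib_mat_vec[OF A])
  qed
  moreover have "(unit_vec nc i - unit_vec nc j :: 'a Matrix.vec) \<noteq> 0\<^sub>v nc"
  proof
    assume "(unit_vec nc i - unit_vec nc j :: 'a Matrix.vec) = 0\<^sub>v nc"
    then have "(unit_vec nc i - unit_vec nc j :: 'a Matrix.vec) $ i = 0\<^sub>v nc $ i"
      by simp
    then show False
      using ij by simp
  qed
  ultimately show ?thesis
    by (meson minus_carrier_vec unit_vec_carrier)
qed

text \<open>Full column rank is triviality of the kernel, and the kernel of the stacked matrix is
  the intersection of the kernels of the blocks \<open>C A^k\<close>.\<close>

lemma observable_iff_trivial_kernel:
  assumes A: "A \<in> carrier_mat n n" and C: "C \<in> carrier_mat m n"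
  shows "observable A C \<longleftrightarrow>
    (\<forall>v\<in>carrier_vec n. (\<forall>k<n. C *\<^sub>v ((A ^\<^sub>m k) *\<^sub>v v) = 0\<^sub>v m) \<longrightarrow> v = 0\<^sub>v n)"
proof -
  let ?O = "observability_matrix A C"
  let ?rs = "concat (map (\<lambda>k. rows (C * A ^\<^sub>m k)) [0..<n])"
  interpret vec_space "TYPE(real)" "dim_row ?O" .
  have O: "?O \<in> carrier_mat (dim_row ?O) n"
    using A by (auto simp: observability_matrix_def)
  have Om: "?O = mat_of_rows n ?rs"
    using A by (simp add: observability_matrix_def)
  have CA: "C * A ^\<^sub>m k \<in> carrier_mat m n" for k
    using A C by auto
  have "?O *\<^sub>v v = 0\<^sub>v (dim_row ?O) \<longleftrightarrow> (\<forall>k<n. C *\<^sub>v ((A ^\<^sub>m k) *\<^sub>v v) = 0\<^sub>v m)"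
    if v: "v \<in> carrier_vec n" for v
  proof -
    have sub: "set ?rs \<subseteq> carrier_vec n"
    proof -
      have "Matrix.row (C * A ^\<^sub>m k) j \<in> carrier_vec n" for k j
        using row_carrier[of "C * A ^\<^sub>m k" j] carrier_matD(2)[OF CA[of k]] by simp
      then show ?thesis
        by (auto simp: rows_def)
    qed
    have row: "Matrix.row (mat_of_rows n ?rs) i = ?rs ! i" if "i < length ?rs" for i
      using that sub nth_mem by (intro mat_of_rows_row) blast+
    have "?O *\<^sub>v v = 0\<^sub>v (dim_row ?O) \<longleftrightarrow> (\<forall>i<length ?rs. Matrix.row (mat_of_rows n ?rs) i \<bullet> v = 0)"
      unfolding Om vec_eq_iff by simp
    also have "\<dots> \<longleftrightarrow> (\<forall>i<length ?rs. (?rs ! i) \<bullet> v = 0)"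
      using row by (simp del: length_concat)
    also have "\<dots> \<longleftrightarrow> (\<forall>r\<in>set ?rs. r \<bullet> v = 0)"
      unfolding all_set_conv_all_nth ..
    also have "\<dots> \<longleftrightarrow> (\<forall>k<n. \<forall>r\<in>set (rows (C * A ^\<^sub>m k)). r \<bullet> v = 0)"
      by auto
    also have "\<dots> \<longleftrightarrow> (\<forall>k<n. (C * A ^\<^sub>m k) *\<^sub>v v = 0\<^sub>v m)"
    proof -
      have "(\<forall>r\<in>set (rows (C * A ^\<^sub>m k)). r \<bullet> v = 0) \<longleftrightarrow> (C * A ^\<^sub>m k) *\<^sub>v v = 0\<^sub>v m" for k
        using C unfolding vec_eq_iff rows_def by auto
      then show ?thesis by simp
    qed
    also have "\<dots> \<longleftrightarrow> (\<forall>k<n. C *\<^sub>v ((A ^\<^sub>m k) *\<^sub>v v) = 0\<^sub>v m)"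
      using A C v by (simp add: assoc_mult_mat_vec[OF C pow_carrier_mat[OF A]])
    finally show ?thesis .
  qed
  then show ?thesis
    using full_rank_iff_trivial_kernel[OF O] A by (auto simp: observable_def)
qed

section \<open>The system matrices\<close>

lemma map_companion_mat:
  "map_mat complex_of_real (companion_mat h) = companion_mat (map_poly complex_of_real h)"
  by (rule eq_matI) (auto simp: companion_mat_def)

lemma degree_hat_mult: "degree (hat_poly p a * hat_poly q c) = p + q"
  by (subst degree_mult_eq) auto

lemma lead_coeff_hat_mult: "poly.coeff (hat_poly p a * hat_poly q c) (p + q) = 1"
  using lead_coeff_mult[of "hat_poly p a" "hat_poly q c"]
  by (simp add: degree_hat_mult lead_coeff_hat_poly)

text \<open>The outer product \<open>e g^T\<close> has \<open>g\<close> as its first row and zeros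
  elsewhere, so subtracting it from the shift matrix changes the top row only.\<close>

lemma G_mat_eq_companion:
  assumes "p \<ge> 1"
  shows "G_mat p q a c = companion_mat (hat_poly p a * hat_poly q c)"
proof -
  note deg = degree_hat_mult[of p a q c]
  show ?thesis
  proof (rule eq_matI)
    fix i j assume "i < dim_row (companion_mat (hat_poly p a * hat_poly q c))"
      "j < dim_col (companion_mat (hat_poly p a * hat_poly q c))"
    then have "i < p + q" "j < p + q" by (simp_all add: deg)
    then show "G_mat p q a c $$ (i, j) = companion_mat (hat_poly p a * hat_poly q c) $$ (i, j)"
      by (auto simp: G_mat_def shift_mat_def companion_mat_def deg g_vec_def scalar_prod_def
          mat_of_rows_index mat_of_cols_index unit_vec_def)
  qed (simp_all add: deg G_mat_def shift_mat_def)
qed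

lemma G_mat_carrier:
  assumes "p \<ge> 1"
  shows "G_mat p q a c \<in> carrier_mat (p + q) (p + q)"
  using companion_mat_carrier[of "hat_poly p a * hat_poly q c"]
  by (simp add: G_mat_eq_companion[OF assms] degree_hat_mult)

section \<open>The transfer function of the system\<close>

text \<open>A row of ascending \<open>lag_poly\<close> coefficients paired with descending powers
  evaluates \<open>hat_poly\<close>; the offset of the row accounts for the remaining power of
  \<open>z\<close>.\<close>

lemma band_mat_mult_power_vec:
  fixes z :: complex
  assumes "i < m"
  shows "(map_mat complex_of_real (band_mat m (m + k) (lag_poly k b)) *\<^sub>v power_vec (m + k) z) $ i
    = z ^ (m - 1 - i) * cpoly (hat_poly k b) z"
proof -
  let ?f = "\<lambda>l. complex_of_real (poly.coeff (lag_poly k b) l)"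
  have "(map_mat complex_of_real (band_mat m (m + k) (lag_poly k b)) *\<^sub>v power_vec (m + k) z) $ i
      = (\<Sum>j=0..<m + k. (if i \<le> j then ?f (j - i) else 0) * z ^ (m + k - 1 - j))"
    using assms by (simp add: band_mat_def power_vec_def scalar_prod_def if_distrib cong: if_cong)
  \<comment> \<open>Outside this window the coefficients of \<open>lag_poly k b\<close> vanish; the
    window fits into the row because \<open>i < m\<close>.\<close>
  also have "\<dots> = (\<Sum>j\<in>{i..i + k}. ?f (j - i) * z ^ (m + k - 1 - j))"
    using assms by (intro sum.mono_neutral_cong_right) (auto simp: coeff_lag_poly)
  also have "\<dots> = (\<Sum>l\<in>{0..k}. ?f l * z ^ (m + k - 1 - (l + i)))"
    using sum.shift_bounds_cl_nat_ivl[of "\<lambda>j. ?f (j - i) * z ^ (m + k - 1 - j)" 0 i k]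
    by (simp add: add.commute)
  also have "\<dots> = (\<Sum>l\<in>{0..k}. z ^ (m - 1 - i) * (?f l * z ^ (k - l)))"
  proof (rule sum.cong)
    fix l assume "l \<in> {0..k}"
    then have "m + k - 1 - (l + i) = (m - 1 - i) + (k - l)"
      using assms by auto
    then show "?f l * z ^ (m + k - 1 - (l + i)) = z ^ (m - 1 - i) * (?f l * z ^ (k - l))"
      by (simp add: power_add)
  qed simp
  also have "\<dots> = z ^ (m - 1 - i) * cpoly (hat_poly k b) z"
    by (simp add: cpoly_hat_sum sum_distrib_left atLeast0AtMost)
  finally show ?thesis .
qed

lemma band_mat_carrier [simp]: "band_mat m n f \<in> carrier_mat m n"
  by (simp add: band_mat_def)

lemma R_mat_carrier [simp]: "R_mat p q a c \<in> carrier_mat (p + q) (p + q)"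
  unfolding R_mat_def by (intro carrier_append_rows) auto

lemma map_R_mat_mult_power_vec:
  "map_mat complex_of_real (R_mat p q a c) *\<^sub>v power_vec (p + q) z
    = (cpoly (hat_poly q c) z \<cdot>\<^sub>v power_vec p z) @\<^sub>v (- cpoly (hat_poly p a) z \<cdot>\<^sub>v power_vec q z)"
proof -
  let ?A = "map_mat complex_of_real (band_mat p (p + q) (lag_poly q c))"
  let ?B = "map_mat complex_of_real (band_mat q (p + q) (lag_poly p a))"
  have "map_mat complex_of_real (R_mat p q a c) = ?A @\<^sub>r (- ?B)"
    by (rule eq_matI) (auto simp: R_mat_def append_rows_def band_mat_def)
  then have "map_mat complex_of_real (R_mat p q a c) *\<^sub>v power_vec (p + q) z
      = (?A *\<^sub>v power_vec (p + q) z) @\<^sub>v ((- ?B) *\<^sub>v power_vec (p + q) z)"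
    by (simp add: mat_mult_append[of _ p "p + q" _ q])
  also have "?A *\<^sub>v power_vec (p + q) z = cpoly (hat_poly q c) z \<cdot>\<^sub>v power_vec p z"
    by (rule eq_vecI)
       (use band_mat_mult_power_vec[of _ p q c z] in
         \<open>auto simp: power_vec_def band_mat_def simp del: index_mult_mat_vec\<close>)
  also have "(- ?B) *\<^sub>v power_vec (p + q) z = - cpoly (hat_poly p a) z \<cdot>\<^sub>v power_vec q z"
  proof (rule eq_vecI)
    fix i assume "i < dim_vec (- cpoly (hat_poly p a) z \<cdot>\<^sub>v power_vec q z)"
    then have i: "i < q" by simp
    have "((- ?B) *\<^sub>v power_vec (p + q) z) $ i = - ((?B *\<^sub>v power_vec (q + p) z) $ i)"
      using i by (simp add: band_mat_def add.commute uminus_scalar_prod[symmetric])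
    then show "((- ?B) *\<^sub>v power_vec (p + q) z) $ i = (- cpoly (hat_poly p a) z \<cdot>\<^sub>v power_vec q z) $ i"
      using i band_mat_mult_power_vec[of i q p a z] by (simp add: power_vec_def add.commute)
  qed (simp add: band_mat_def)
  finally show ?thesis .
qed

lemma tau_eq:
  "tau p q a c z = ((1 / cpoly (hat_poly p a) z) \<cdot>\<^sub>v power_vec p z)
    @\<^sub>v ((- 1 / cpoly (hat_poly q c) z) \<cdot>\<^sub>v power_vec q z)"
  by (simp add: tau_def ustar_def power_vec_def)

lemma eigenvalue_G_mat:
  assumes "p \<ge> 1"
  shows "eigenvalue (map_mat complex_of_real (G_mat p q a c)) z
    \<longleftrightarrow> cpoly (hat_poly p a) z = 0 \<or> cpoly (hat_poly q c) z = 0"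
  unfolding G_mat_eq_companion[OF assms] map_companion_mat
  using assms cpoly_mult[of "hat_poly p a" "hat_poly q c" z]
  by (subst eigenvalue_companion)
     (simp_all add: degree_hat_mult lead_coeff_hat_mult flip: cpoly_def)

lemma realizes_G_mat:
  assumes "p \<ge> 1"
  shows "realizes (G_mat p q a c) (unit_vec (p + q) 0) (R_mat p q a c) (tau p q a c)"
  unfolding realizes_def
proof (intro allI impI)
  fix z assume "\<not> eigenvalue (map_mat complex_of_real (G_mat p q a c)) z"
  then have nz: "cpoly (hat_poly p a) z \<noteq> 0" "cpoly (hat_poly q c) z \<noteq> 0"
    using eigenvalue_G_mat[OF assms] by auto
  let ?h = "map_poly complex_of_real (hat_poly p a * hat_poly q c)"
  have deg: "degree ?h = p + q" and lead: "lead_coeff ?h = 1"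
    by (simp_all add: degree_hat_mult lead_coeff_hat_mult)
  have hz: "poly ?h z = cpoly (hat_poly p a) z * cpoly (hat_poly q c) z"
    by (simp add: cpoly_def map_poly_of_real.hom_mult)
  have unit: "map_vec complex_of_real (unit_vec (p + q) 0) = unit_vec (p + q) 0"
    by (rule eq_vecI) (auto simp: unit_vec_def)
  have dim: "dim_row (G_mat p q a c) = p + q"
    by (simp add: G_mat_eq_companion[OF assms] degree_hat_mult)
  have "system_transfer (G_mat p q a c) (unit_vec (p + q) 0) (R_mat p q a c) z
      = map_mat complex_of_real (R_mat p q a c) *\<^sub>v
          (the (mat_inverse (z \<cdot>\<^sub>m 1\<^sub>m (degree ?h) - companion_mat ?h)) *\<^sub>v unit_vec (degree ?h) 0)"
    unfolding system_transfer_def unit dim deg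
    unfolding G_mat_eq_companion[OF assms] map_companion_mat ..
  also have "\<dots> = map_mat complex_of_real (R_mat p q a c) *\<^sub>v ((1 / poly ?h z) \<cdot>\<^sub>v power_vec (p + q) z)"
    using companion_resolvent[of ?h z] lead deg nz hz assms by simp
  also have "\<dots> = (1 / poly ?h z) \<cdot>\<^sub>v (map_mat complex_of_real (R_mat p q a c) *\<^sub>v power_vec (p + q) z)"
    by (rule mult_mat_vec[of _ "p + q" "p + q"]) auto
  \<comment> \<open>In each block one of the two factors of \<open>h(z)\<close> cancels, leaving
    \<open>1 / a'(z)\<close> above and \<open>-1 / c'(z)\<close> below.\<close>
  also have "\<dots> = tau p q a c z"
    unfolding map_R_mat_mult_power_vec tau_eq hz
    by (rule eq_vecI) (use nz in auto)
  finally show "system_transfer (G_mat p q a c) (unit_vec (p + q) 0) (R_mat p q a c) z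
      = tau p q a c z" .
qed

section \<open>Observability and common zeros\<close>

text \<open>The map \<open>z \<mapsto> 1 / z\<close> exchanges the nonzero roots of a polynomial and
  its reciprocal. The reciprocals take the value 1 at 0, and the first assumption keeps 0 from being
  a common root of the other pair.\<close>

lemma hat_polys_common_root_iff:
  assumes "a p \<noteq> 0 \<or> c q \<noteq> 0" and "p \<ge> 1" and "q \<ge> 1"
  shows "(\<exists>z. cpoly (hat_poly p a) z = 0 \<and> cpoly (hat_poly q c) z = 0)
    \<longleftrightarrow> (\<exists>z. cpoly (lag_poly p a) z = 0 \<and> cpoly (lag_poly q c) z = 0)"
proof
  assume "\<exists>z. cpoly (hat_poly p a) z = 0 \<and> cpoly (hat_poly q c) z = 0"
  then obtain z where z: "cpoly (hat_poly p a) z = 0" "cpoly (hat_poly q c) z = 0" by blast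
  have "cpoly (hat_poly p a) 0 = of_real (a p)" "cpoly (hat_poly q c) 0 = of_real (c q)"
    using assms(2,3) by (auto simp: cpoly_def poly_0_coeff_0 coeff_hat_poly)
  then have "z \<noteq> 0"
    using z assms(1) by auto
  then show "\<exists>z. cpoly (lag_poly p a) z = 0 \<and> cpoly (lag_poly q c) z = 0"
    using z by (intro exI[of _ "1 / z"]) (simp add: cpoly_hat_conv_lag)
next
  assume "\<exists>z. cpoly (lag_poly p a) z = 0 \<and> cpoly (lag_poly q c) z = 0"
  then obtain z where z: "cpoly (lag_poly p a) z = 0" "cpoly (lag_poly q c) z = 0" by blast
  have "cpoly (lag_poly p a) 0 = 1"
    by (simp add: cpoly_def poly_0_coeff_0 coeff_lag_poly)
  then have "z \<noteq> 0"
    using z by auto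
  then show "\<exists>z. cpoly (hat_poly p a) z = 0 \<and> cpoly (hat_poly q c) z = 0"
    using z by (intro exI[of _ "1 / z"]) (simp add: cpoly_hat_conv_lag)
qed

text \<open>The common root may be nonreal while observability is about real vectors. As
  \<open>G\<close> and \<open>C\<close> are real, the real part of the complex eigenvector is also
  annihilated by all \<open>C G^k\<close>.\<close>

lemma not_observable_common_root:
  assumes "p \<ge> 1" and z: "cpoly (hat_poly p a) z = 0" "cpoly (hat_poly q c) z = 0"
  shows "\<not> observable (G_mat p q a c) (R_mat p q a c)"
proof
  let ?G = "G_mat p q a c" and ?R = "R_mat p q a c" and ?n = "p + q"
  let ?w = "power_vec ?n z"
  let ?v = "map_vec Re ?w"
  assume obs: "observable ?G ?R"
  note G = G_mat_carrier[OF assms(1), of q a c]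
  have Re_mult: "map_vec Re (map_mat complex_of_real X *\<^sub>v u) = X *\<^sub>v map_vec Re u"
    if "X \<in> carrier_mat ?n ?n" "u \<in> carrier_vec ?n" for X u
    using that by (intro eq_vecI) (auto simp: scalar_prod_def)
  let ?h = "map_poly complex_of_real (hat_poly p a * hat_poly q c)"
  have "eigenvector (map_mat complex_of_real ?G) ?w z"
    using companion_eigenvector[of ?h z] assms
    unfolding G_mat_eq_companion[OF assms(1)] map_companion_mat
    by (simp add: degree_hat_mult lead_coeff_hat_mult cpoly_mult flip: cpoly_def)
  then have pow: "map_mat complex_of_real ?G ^\<^sub>m k *\<^sub>v ?w = z ^ k \<cdot>\<^sub>v ?w" for k
    using eigenvector_pow[of "map_mat complex_of_real ?G" ?n] G by simp
  have hom_pow: "map_mat complex_of_real (?G ^\<^sub>m k) = map_mat complex_of_real ?G ^\<^sub>m k" for k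
    by (rule of_real_hom.mat_hom_pow[OF G])
  have Rw: "map_mat complex_of_real ?R *\<^sub>v ?w = 0\<^sub>v ?n"
    unfolding map_R_mat_mult_power_vec z by (rule eq_vecI) auto
  have "?R *\<^sub>v ((?G ^\<^sub>m k) *\<^sub>v ?v) = 0\<^sub>v ?n" for k
  proof -
    have "(?G ^\<^sub>m k) *\<^sub>v ?v = map_vec Re (z ^ k \<cdot>\<^sub>v ?w)"
      using Re_mult[OF pow_carrier_mat[OF G], of ?w k] by (simp add: hom_pow pow)
    then have "?R *\<^sub>v ((?G ^\<^sub>m k) *\<^sub>v ?v) = map_vec Re (map_mat complex_of_real ?R *\<^sub>v (z ^ k \<cdot>\<^sub>v ?w))"
      by (simp add: Re_mult)
    also have "map_mat complex_of_real ?R *\<^sub>v (z ^ k \<cdot>\<^sub>v ?w) = 0\<^sub>v ?n"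
      by (subst mult_mat_vec[of _ ?n ?n]) (auto simp: Rw)
    finally show ?thesis by auto
  qed
  then have "?v = 0\<^sub>v ?n"
    using obs observable_iff_trivial_kernel[OF G R_mat_carrier] by simp
  \<comment> \<open>The last entry of \<open>?w\<close> is 1, so its real part cannot vanish; the
    imaginary part would not do, being zero for real \<open>z\<close>.\<close>
  then have "?v $ (?n - 1) = (0\<^sub>v ?n :: real Matrix.vec) $ (?n - 1)"
    by simp
  then show False
    using assms(1) by (simp add: power_vec_def)
qed

lemma observable_no_common_root:
  assumes "p \<ge> 1" and nz: "\<not> (\<exists>z. cpoly (hat_poly p a) z = 0 \<and> cpoly (hat_poly q c) z = 0)"
  shows "observable (G_mat p q a c) (R_mat p q a c)"
proof -
  let ?G = "G_mat p q a c" and ?R = "R_mat p q a c" and ?n = "p + q"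
  \<comment> \<open>In this order of arguments the first \<open>p\<close> rows carry the
    coefficients of \<open>hat_poly q c\<close>, as in \<open>R_mat\<close>.\<close>
  let ?S = "sylvester_mat (hat_poly q c) (hat_poly p a)"
  note G = G_mat_carrier[OF assms(1), of q a c]
  have S: "?S \<in> carrier_mat ?n ?n"
    using sylvester_carrier_mat[of "hat_poly q c" "hat_poly p a"] by (simp add: add.commute)
  let ?d = "gcd (hat_poly q c) (hat_poly p a)"
  have "degree ?d = 0"
  proof (rule ccontr)
    assume "degree ?d \<noteq> 0"
    \<comment> \<open>A nonconstant real gcd has a complex root, which would be common to both
      polynomials.\<close>
    then have "\<not> constant (poly (map_poly complex_of_real ?d))"
      by (simp only: constant_degree degree_map_poly_of_real not_False_eq_True)
    from Fundamental_Theorem_Algebra.fundamental_theorem_of_algebra[OF this]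
    obtain z where z: "cpoly ?d z = 0"
      unfolding cpoly_def ..
    have dvd: "cpoly f z = 0" if d: "?d dvd f" for f
    proof -
      obtain k where "f = ?d * k"
        using d by (rule dvdE)
      then show ?thesis
        by (simp only: cpoly_mult z mult_zero_left)
    qed
    show False
      using nz dvd[OF gcd_dvd1] dvd[OF gcd_dvd2] by blast
  qed
  then have "det ?S \<noteq> 0"
    using resultant_0_gcd[of "hat_poly q c" "hat_poly p a"] by (simp add: resultant_def)
  have row: "(?S *\<^sub>v v) $ i = (if i < p then 1 else -1) * (?R *\<^sub>v v) $ i"
    if "i < ?n" "v \<in> carrier_vec ?n" for v i
  proof -
    have "?S $$ (i, j) = (if i < p then 1 else -1) * ?R $$ (i, j)" if j: "j < ?n" for j
    proof (cases "i < p")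
      case True
      have "?S $$ (i, j) = (if i \<le> j \<and> j - i \<le> q then poly.coeff (hat_poly q c) (q + i - j) else 0)"
        using True j \<open>i < ?n\<close> by (subst sylvester_index_mat) auto
      \<comment> \<open>Descending coefficients of \<open>hat_poly\<close> are ascending
        coefficients of \<open>lag_poly\<close>.\<close>
      also have "\<dots> = (if i \<le> j then poly.coeff (lag_poly q c) (j - i) else 0)"
        by (auto simp: coeff_hat_poly coeff_lag_poly)
      also have "\<dots> = ?R $$ (i, j)"
        using True j by (simp add: R_mat_def append_rows_def band_mat_def)
      finally show ?thesis
        using True by simp
    next
      case False
      have "?S $$ (i, j) = (if i - p \<le> j \<and> j \<le> i then poly.coeff (hat_poly p a) (i - j) else 0)"
        using False j \<open>i < ?n\<close> by (subst sylvester_index_mat) auto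
      also have "\<dots> = (if i - p \<le> j then poly.coeff (lag_poly p a) (j - (i - p)) else 0)"
        using False by (auto simp: coeff_hat_poly coeff_lag_poly add.commute)
      also have "\<dots> = - ?R $$ (i, j)"
        using False j \<open>i < ?n\<close> by (simp add: R_mat_def append_rows_def band_mat_def)
      finally show ?thesis
        using False by simp
    qed
    then have "(\<Sum>j=0..<?n. ?S $$ (i, j) * v $ j)
        = (\<Sum>j=0..<?n. (if i < p then 1 else -1) * (?R $$ (i, j) * v $ j))"
      by (intro sum.cong) simp_all
    moreover have "(?S *\<^sub>v v) $ i = (\<Sum>j=0..<?n. ?S $$ (i, j) * v $ j)"
      using that carrier_matD[OF S] by (simp add: scalar_prod_def del: sylvester_mat_dim)
    moreover have "(?R *\<^sub>v v) $ i = (\<Sum>j=0..<?n. ?R $$ (i, j) * v $ j)"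
      using that carrier_matD[OF R_mat_carrier, of p q a c] by (simp add: scalar_prod_def)
    ultimately show ?thesis
      by (simp only: sum_distrib_left)
  qed
  show ?thesis
    unfolding observable_iff_trivial_kernel[OF G R_mat_carrier]
  proof (intro ballI impI)
    fix v :: "real Matrix.vec"
    assume v: "v \<in> carrier_vec ?n" and "\<forall>k<?n. ?R *\<^sub>v (?G ^\<^sub>m k *\<^sub>v v) = 0\<^sub>v ?n"
    moreover have "0 < ?n"
      using assms(1) by simp
    \<comment> \<open>The block \<open>k = 0\<close> is \<open>C\<close> itself, whose kernel is
      already trivial.\<close>
    ultimately have "?R *\<^sub>v (?G ^\<^sub>m 0 *\<^sub>v v) = 0\<^sub>v ?n"
      by blast
    then have "?R *\<^sub>v v = 0\<^sub>v ?n"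
      using v carrier_matD(1)[OF G] by simp
    then have "?S *\<^sub>v v = 0\<^sub>v ?n"
      using row[OF _ v] carrier_matD(1)[OF S]
      by (intro eq_vecI) (simp_all del: index_mult_mat_vec sylvester_mat_dim)
    then show "v = 0\<^sub>v ?n"
      using \<open>det ?S \<noteq> 0\<close> det_0_iff_vec_prod_zero[OF S] v by blast
  qed
qed

section \<open>Filtered white noise\<close>

text \<open>Exchanging sum and expectation bounds the expected sum of absolute values by
  \<open>(1 + v)\<close> times the sum of the \<open>\<bar>\<psi> k\<bar>\<close>. A nonnegative
  variable of finite expectation is finite almost surely.\<close>

lemma white_noise_filter_summable:
  assumes wn: "white_noise M \<epsilon>" and \<psi>: "summable (\<lambda>k. \<bar>\<psi> k\<bar>)"
  shows "AE \<omega> in M. summable (\<lambda>k. \<psi> k * \<epsilon> (t - int k) \<omega>)"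
proof -
  interpret prob_space M
    using wn by (simp add: white_noise_def)
  have meas [measurable]: "\<epsilon> s \<in> borel_measurable M" for s
    using wn by (simp add: white_noise_def)
  have int: "integrable M (\<lambda>\<omega>. (\<epsilon> s \<omega>)\<^sup>2)" for s
    using wn by (simp add: white_noise_def)
  obtain v where "\<forall>s t. integral\<^sup>L M (\<lambda>\<omega>. \<epsilon> s \<omega> * \<epsilon> t \<omega>) = (if s = t then v else 0)"
    using wn unfolding white_noise_def by blast
  then have v: "integral\<^sup>L M (\<lambda>\<omega>. (\<epsilon> s \<omega>)\<^sup>2) = v" for s
    by (simp add: power2_eq_square)
  \<comment> \<open>The bound \<open>\<bar>x\<bar> \<le> 1 + x^2\<close> reduces the first moment to
    the second, which is the same \<open>v\<close> at all times.\<close>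
  have bound: "(\<integral>\<^sup>+\<omega>. ennreal \<bar>\<epsilon> s \<omega>\<bar> \<partial>M) \<le> ennreal (1 + v)" for s
  proof -
    have "\<bar>x\<bar> \<le> 1 + x\<^sup>2" for x :: real
      using sum_squares_bound[of 1 "\<bar>x\<bar>"] by (simp add: power2_eq_square)
    then have "(\<integral>\<^sup>+\<omega>. ennreal \<bar>\<epsilon> s \<omega>\<bar> \<partial>M) \<le> (\<integral>\<^sup>+\<omega>. ennreal (1 + (\<epsilon> s \<omega>)\<^sup>2) \<partial>M)"
      by (intro nn_integral_mono ennreal_leI)
    also have "\<dots> = ennreal (\<integral>\<omega>. 1 + (\<epsilon> s \<omega>)\<^sup>2 \<partial>M)"
      using int[of s] by (intro nn_integral_eq_integral) auto
    also have "(\<integral>\<omega>. 1 + (\<epsilon> s \<omega>)\<^sup>2 \<partial>M) = 1 + v"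
      using int[of s] by (simp add: v prob_space)
    finally show ?thesis .
  qed
  \<comment> \<open>The sign of \<open>v\<close> is recovered from its being a second moment;
    products in \<open>ennreal\<close> require it below.\<close>
  have "0 \<le> v"
    unfolding v[of 0, symmetric] by (rule Bochner_Integration.integral_nonneg) simp
  have "(\<integral>\<^sup>+\<omega>. (\<Sum>k. ennreal \<bar>\<psi> k * \<epsilon> (t - int k) \<omega>\<bar>) \<partial>M)
      = (\<Sum>k. \<integral>\<^sup>+\<omega>. ennreal \<bar>\<psi> k * \<epsilon> (t - int k) \<omega>\<bar> \<partial>M)"
    by (rule nn_integral_suminf) measurable
  also have "\<dots> = (\<Sum>k. ennreal \<bar>\<psi> k\<bar> * (\<integral>\<^sup>+\<omega>. ennreal \<bar>\<epsilon> (t - int k) \<omega>\<bar> \<partial>M))"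
    by (simp add: abs_mult ennreal_mult nn_integral_cmult)
  also have "\<dots> \<le> (\<Sum>k. ennreal \<bar>\<psi> k\<bar> * ennreal (1 + v))"
    by (intro suminf_le summableI mult_left_mono bound) simp
  also have "\<dots> = ennreal (\<Sum>k. \<bar>\<psi> k\<bar> * (1 + v))"
    using \<open>0 \<le> v\<close> \<psi>
    by (subst suminf_ennreal2[symmetric]) (auto simp: ennreal_mult intro: summable_mult2)
  also have "\<dots> < \<infinity>"
    by simp
  finally have "AE \<omega> in M. (\<Sum>k. ennreal \<bar>\<psi> k * \<epsilon> (t - int k) \<omega>\<bar>) \<noteq> \<infinity>"
    by (intro nn_integral_PInf_AE) auto
  then show ?thesis
  proof (rule AE_mp, intro AE_I2 impI)
    fix \<omega> assume "(\<Sum>k. ennreal \<bar>\<psi> k * \<epsilon> (t - int k) \<omega>\<bar>) \<noteq> \<infinity>"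
    then have "summable (\<lambda>k. \<bar>\<psi> k * \<epsilon> (t - int k) \<omega>\<bar>)"
      by (intro summable_suminf_not_top) auto
    then show "summable (\<lambda>k. \<psi> k * \<epsilon> (t - int k) \<omega>)"
      by (rule summable_rabs_cancel)
  qed
qed

section \<open>Power series of the reciprocals\<close>

text \<open>Embedding the coefficients respects Cauchy products, and inverses are unique. This
  carries convergence results from complex series back to the real filter coefficients.\<close>

lemma inverse_fps_of_real_poly:
  assumes "poly.coeff f 0 \<noteq> 0"
  shows "fps_nth (inverse (fps_of_poly (map_poly complex_of_real f))) k
    = complex_of_real (fps_nth (inverse (fps_of_poly f)) k)"
proof -
  let ?F = "fps_of_poly (map_poly complex_of_real f)"
  let ?H = "Abs_fps (\<lambda>k. complex_of_real (fps_nth (inverse (fps_of_poly f)) k))"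
  have "?F * ?H = 1"
  proof (rule fps_ext)
    fix n
    have "fps_nth (?F * ?H) n = complex_of_real (fps_nth (fps_of_poly f * inverse (fps_of_poly f)) n)"
      by (simp add: fps_mult_nth)
    also have "fps_of_poly f * inverse (fps_of_poly f) = 1"
      using assms by (intro inverse_mult_eq_1') simp
    finally show "fps_nth (?F * ?H) n = fps_nth 1 n"
      by (cases n) simp_all
  qed
  then have "inverse ?F = ?H"
    by (rule fps_inverse_unique)
  then show ?thesis
    by simp
qed

text \<open>The finitely many roots stay away from the closed unit disc, so the reciprocal is
  analytic on a disc of radius \<open>R > 1\<close>. Its expansion converges absolutely at 1 and
  represents it on the closed unit disc.\<close>

lemma inverse_fps_of_poly_disc:
  assumes "\<forall>z. cmod z \<le> 1 \<longrightarrow> cpoly f z \<noteq> 0"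
  shows "summable (\<lambda>k. \<bar>fps_nth (inverse (fps_of_poly f)) k\<bar>)"
    and "\<And>w. cmod w \<le> 1 \<Longrightarrow>
      (\<lambda>k. complex_of_real (fps_nth (inverse (fps_of_poly f)) k) * w ^ k) sums (1 / cpoly f w)"
proof -
  let ?g = "map_poly complex_of_real f"
  let ?F = "fps_of_poly ?g"
  have nz0: "poly.coeff f 0 \<noteq> 0"
    using assms[THEN spec, of 0] by (simp add: cpoly_def poly_0_coeff_0 coeff_map_poly)
  then have "?g \<noteq> 0"
    by auto
  \<comment> \<open>The extra element 2 keeps the minimum meaningful when \<open>f\<close> has no
    roots; any number above 1 would do.\<close>
  define R where "R = Min (insert 2 (cmod ` {z. poly ?g z = 0}))"
  have fin: "finite (insert 2 (cmod ` {z. poly ?g z = 0}))"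
    using poly_roots_finite[OF \<open>?g \<noteq> 0\<close>] by simp
  have "R > 1"
  proof -
    have "1 < cmod z" if "poly ?g z = 0" for z
      using assms that unfolding cpoly_def by (meson not_le)
    then show ?thesis
      unfolding R_def using fin by (subst Min_gr_iff) auto
  qed
  have nz: "eval_fps ?F z \<noteq> 0" if "ereal (norm z) < ereal R" for z
  proof
    assume "eval_fps ?F z = 0"
    then have "R \<le> cmod z"
      unfolding R_def using fin by (intro Min_le) auto
    then show False
      using that by simp
  qed
  \<comment> \<open>A polynomial has infinite convergence radius, so only its zeros limit that of
    the inverse.\<close>
  have rad: "fps_conv_radius (inverse ?F) \<ge> ereal R"
    using fps_conv_radius_inverse[of "ereal R" ?F] nz by simp
  show "summable (\<lambda>k. \<bar>fps_nth (inverse (fps_of_poly f)) k\<bar>)"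
  proof -
    have "ereal (norm (1 :: complex)) < ereal R"
      using \<open>R > 1\<close> by simp
    also note rad
    finally have "summable (\<lambda>k. norm (fps_nth (inverse ?F) k * 1 ^ k))"
      unfolding fps_conv_radius_def by (rule abs_summable_in_conv_radius)
    then show ?thesis
      by (simp add: inverse_fps_of_real_poly[OF nz0])
  qed
  fix w assume "cmod w \<le> 1"
  then have w: "ereal (norm w) < ereal R"
    using \<open>R > 1\<close> by simp
  have "(\<lambda>k. fps_nth (inverse ?F) k * w ^ k) sums eval_fps (inverse ?F) w"
    using w rad by (intro sums_eval_fps) (rule less_le_trans)
  moreover have "eval_fps (inverse ?F) w = 1 / cpoly f w"
    using eval_fps_inverse[of "ereal R" ?F w] nz w by (simp add: cpoly_def inverse_eq_divide)
  ultimately show "(\<lambda>k. complex_of_real (fps_nth (inverse (fps_of_poly f)) k) * w ^ k)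
      sums (1 / cpoly f w)"
    by (simp add: inverse_fps_of_real_poly[OF nz0])
qed

text \<open>Zeros of \<open>lag_poly\<close> are inverses of nonzero zeros of
  \<open>hat_poly\<close>.\<close>

lemma lag_poly_nonzero_disc:
  assumes "\<forall>z. cpoly (hat_poly k a) z = 0 \<longrightarrow> cmod z < 1"
  shows "\<forall>z. cmod z \<le> 1 \<longrightarrow> cpoly (lag_poly k a) z \<noteq> 0"
proof (intro allI impI notI)
  fix z assume z: "cmod z \<le> 1" and 0: "cpoly (lag_poly k a) z = 0"
  then have "z \<noteq> 0"
    by (auto simp: cpoly_def poly_0_coeff_0 coeff_lag_poly)
  then have "cpoly (hat_poly k a) (1 / z) = 0"
    using 0 by (simp add: cpoly_hat_conv_lag)
  then have "cmod (1 / z) < 1"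
    using assms by blast
  then show False
    using z \<open>z \<noteq> 0\<close> by (simp add: norm_divide field_simps)
qed

section \<open>The transfer function of the derivative process\<close>

text \<open>The coefficients of \<open>L^m x(L)\<close>: the impulse response after a lag of
  \<open>m\<close> steps.\<close>

definition delay :: "nat \<Rightarrow> (nat \<Rightarrow> 'a::zero) \<Rightarrow> nat \<Rightarrow> 'a" where
  "delay m x k = (if k < m then 0 else x (k - m))"

lemma delay_sums:
  fixes x :: "nat \<Rightarrow> 'a::real_normed_vector"
  assumes "x sums s"
  shows "delay m x sums s"
proof -
  have "(\<lambda>k. delay m x (k + m)) sums s"
    using assms by (simp add: delay_def)
  then show ?thesis
    by (subst (asm) sums_iff_shift) (simp add: delay_def)
qed

text \<open>The three facts that \<open>has_transfer_function\<close> demands of a coordinate, for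
  the filter \<open>L^m / a(L)\<close>.\<close>

lemma delayed_inverse_lag:
  assumes wn: "white_noise M \<epsilon>"
    and roots: "\<forall>z. cpoly (hat_poly k a) z = 0 \<longrightarrow> cmod z < 1"
    and m: "1 \<le> m" "m \<le> k"
  defines "h \<equiv> delay m (fps_nth (inverse (fps_of_poly (lag_poly k a))))"
  shows "summable (\<lambda>l. \<bar>h l\<bar>)"
    and "AE \<omega> in M. (\<lambda>l. h l * \<epsilon> (t - int l) \<omega>)
      sums lag_filter (inverse (fps_of_poly (lag_poly k a))) \<epsilon> (t - int m) \<omega>"
    and "\<And>z. 1 \<le> cmod z \<Longrightarrow>
      (\<lambda>l. complex_of_real (h l) / z ^ l) sums (z ^ (k - m) / cpoly (hat_poly k a) z)"
proof -
  let ?\<psi> = "fps_nth (inverse (fps_of_poly (lag_poly k a)))"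
  note disc = inverse_fps_of_poly_disc[OF lag_poly_nonzero_disc[OF roots]]
  have "(\<lambda>l. \<bar>h l\<bar>) = delay m (\<lambda>l. \<bar>?\<psi> l\<bar>)"
    by (auto simp: h_def delay_def)
  then show "summable (\<lambda>l. \<bar>h l\<bar>)"
    using sums_summable[OF delay_sums[OF summable_sums[OF disc(1)], of m]] by simp
  show "AE \<omega> in M. (\<lambda>l. h l * \<epsilon> (t - int l) \<omega>)
      sums lag_filter (inverse (fps_of_poly (lag_poly k a))) \<epsilon> (t - int m) \<omega>"
    using white_noise_filter_summable[OF wn disc(1), where t = "t - int m"]
  proof (rule AE_mp, intro AE_I2 impI)
    fix \<omega> assume "summable (\<lambda>l. ?\<psi> l * \<epsilon> (t - int m - int l) \<omega>)"
    then have "delay m (\<lambda>l. ?\<psi> l * \<epsilon> (t - int m - int l) \<omega>)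
        sums lag_filter (inverse (fps_of_poly (lag_poly k a))) \<epsilon> (t - int m) \<omega>"
      unfolding lag_filter_def by (intro delay_sums summable_sums)
    moreover have "delay m (\<lambda>l. ?\<psi> l * \<epsilon> (t - int m - int l) \<omega>) = (\<lambda>l. h l * \<epsilon> (t - int l) \<omega>)"
      by (auto simp: h_def delay_def of_nat_diff)
    ultimately show "(\<lambda>l. h l * \<epsilon> (t - int l) \<omega>)
        sums lag_filter (inverse (fps_of_poly (lag_poly k a))) \<epsilon> (t - int m) \<omega>"
      by simp
  qed
  fix z :: complex assume z: "1 \<le> cmod z"
  then have "z \<noteq> 0" by auto
  \<comment> \<open>The expansion is evaluated at \<open>1 / z\<close>, which lies in the closed
    unit disc.\<close>
  have "(\<lambda>l. complex_of_real (?\<psi> l) * (1 / z) ^ l) sums (1 / cpoly (lag_poly k a) (1 / z))"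
    using z by (intro disc(2)) (simp_all add: norm_divide divide_le_eq_1 \<open>z \<noteq> 0\<close>)
  then have "(\<lambda>l. complex_of_real (?\<psi> l) * (1 / z) ^ l * (1 / z) ^ m)
      sums (1 / cpoly (lag_poly k a) (1 / z) * (1 / z) ^ m)"
    by (rule sums_mult2)
  then have "delay m (\<lambda>l. complex_of_real (?\<psi> l) * (1 / z) ^ l * (1 / z) ^ m)
      sums (1 / cpoly (lag_poly k a) (1 / z) * (1 / z) ^ m)"
    by (rule delay_sums)
  moreover have "delay m (\<lambda>l. complex_of_real (?\<psi> l) * (1 / z) ^ l * (1 / z) ^ m)
      = (\<lambda>l. complex_of_real (h l) / z ^ l)"
    by (auto simp: h_def delay_def power_divide mult.assoc simp flip: power_add)
  \<comment> \<open>Since \<open>a(1/z) = z^(-k) a'(z)\<close>, the delay leaves the power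
    \<open>k - m\<close>, a natural exponent because \<open>m \<le> k\<close>.\<close>
  moreover have "1 / cpoly (lag_poly k a) (1 / z) * (1 / z) ^ m = z ^ (k - m) / cpoly (hat_poly k a) z"
    using \<open>z \<noteq> 0\<close> m(2) by (simp add: cpoly_hat_conv_lag power_divide power_diff)
  ultimately show "(\<lambda>l. complex_of_real (h l) / z ^ l) sums (z ^ (k - m) / cpoly (hat_poly k a) z)"
    by simp
qed

lemma has_transfer_function_tau:
  assumes wn: "white_noise M \<epsilon>"
    and a: "\<forall>z. cpoly (hat_poly p a) z = 0 \<longrightarrow> cmod z < 1"
    and c: "\<forall>z. cpoly (hat_poly q c) z = 0 \<longrightarrow> cmod z < 1"
  shows "has_transfer_function M (p + q) \<epsilon> (xi_process p q a c \<epsilon>) (tau p q a c)"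
proof -
  \<comment> \<open>Impulse responses of the derivatives with lag \<open>m\<close>, up to the sign
    in the \<open>c\<close> block. Coordinates are counted from 0, so a coordinate has lag one more
    than its index in its block.\<close>
  define ha where "ha m = delay m (fps_nth (inverse (fps_of_poly (lag_poly p a))))" for m
  define hc where "hc m = delay m (fps_nth (inverse (fps_of_poly (lag_poly q c))))" for m
  define h where "h k = Matrix.vec p (\<lambda>i. ha (i + 1) k) @\<^sub>v Matrix.vec q (\<lambda>i. - hc (i + 1) k)" for k
  have "summable (\<lambda>k. \<bar>h k $ i\<bar>) \<and>
      (\<forall>t. AE \<omega> in M. (\<lambda>k. h k $ i * \<epsilon> (t - int k) \<omega>) sums (xi_process p q a c \<epsilon> t \<omega> $ i)) \<and>
      (\<forall>z. cmod z \<ge> 1 \<longrightarrow> (\<lambda>k. complex_of_real (h k $ i) / z ^ k) sums (tau p q a c z $ i))"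
    if i: "i < p + q" for i
  proof (cases "i < p")
    case True
    have [simp]: "h k $ i = ha (i + 1) k" for k
      using True by (simp add: h_def)
    have m: "1 \<le> i + 1" "i + 1 \<le> p"
      using True by auto
    note d = delayed_inverse_lag[OF wn a m, folded ha_def]
    have "tau p q a c z $ i = z ^ (p - (i + 1)) / cpoly (hat_poly p a) z" for z
      using True by (simp add: tau_def ustar_def)
    moreover have "xi_process p q a c \<epsilon> t \<omega> $ i
        = lag_filter (inverse (fps_of_poly (lag_poly p a))) \<epsilon> (t - int (i + 1)) \<omega>" for t \<omega>
      using True by (simp add: xi_process_def eps_a_def)
    ultimately show ?thesis
      using d by simp
  next
    case False
    then obtain j where j: "i = p + j"
      using le_Suc_ex[of p i] by auto
    have [simp]: "h k $ i = - hc (j + 1) k" for k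
      using i by (simp add: h_def j)
    have m: "1 \<le> j + 1" "j + 1 \<le> q"
      using i by (auto simp: j)
    note d = delayed_inverse_lag[OF wn c m, folded hc_def]
    have "tau p q a c z $ i = - (z ^ (q - (j + 1)) / cpoly (hat_poly q c) z)" for z
      using i by (simp add: tau_def ustar_def j)
    moreover have "xi_process p q a c \<epsilon> t \<omega> $ i
        = - lag_filter (inverse (fps_of_poly (lag_poly q c))) \<epsilon> (t - int (j + 1)) \<omega>" for t \<omega>
      using i by (simp add: xi_process_def eps_c_def j)
    moreover have "AE \<omega> in M. (\<lambda>k. - (hc (j + 1) k * \<epsilon> (t - int k) \<omega>))
        sums - lag_filter (inverse (fps_of_poly (lag_poly q c))) \<epsilon> (t - int (j + 1)) \<omega>" for t
      using d(2)[of t] by (rule eventually_mono) (rule sums_minus)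
    ultimately show ?thesis
      using d(1) d(3)[THEN sums_minus] by simp
  qed
  then show ?thesis
    unfolding has_transfer_function_def
    by (intro conjI exI[of _ h]) (auto simp: xi_process_def tau_def ustar_def)
qed

text \<open>The equivalence carries the proviso \<open>a p \<noteq> 0 \<or> c q \<noteq> 0\<close>:
  if both vanish, 0 is a common root of \<open>a'\<close> and \<open>c'\<close>, so observability
  fails, although 0 is not a zero of \<open>a\<close> or \<open>c\<close> and these may have no
  common zero.\<close>

theorem proposition2p2:
  fixes p q :: nat and a c :: "nat \<Rightarrow> real"
    and M :: "'w measure" and \<epsilon> :: "int \<Rightarrow> 'w \<Rightarrow> real"
  assumes "p \<ge> 1" and "q \<ge> 1"
    and "\<And>z. cpoly (hat_poly p a) z = 0 \<Longrightarrow> cmod z < 1"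
    and "\<And>z. cpoly (hat_poly q c) z = 0 \<Longrightarrow> cmod z < 1"
    and "white_noise M \<epsilon>"
  shows "has_transfer_function M (p + q) \<epsilon> (xi_process p q a c \<epsilon>) (tau p q a c) \<and>
    realizes (G_mat p q a c) (unit_vec (p + q) 0) (R_mat p q a c) (tau p q a c) \<and>
    stable_mat (G_mat p q a c) \<and>
    controllable (G_mat p q a c) (unit_vec (p + q) 0) \<and>
    (a p \<noteq> 0 \<or> c q \<noteq> 0 \<longrightarrow>
      (observable (G_mat p q a c) (R_mat p q a c) \<longleftrightarrow>
        \<not> (\<exists>z. cpoly (lag_poly p a) z = 0 \<and> cpoly (lag_poly q c) z = 0)))"
proof (intro conjI impI)
  show "has_transfer_function M (p + q) \<epsilon> (xi_process p q a c \<epsilon>) (tau p q a c)"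
    using assms(3-5) by (intro has_transfer_function_tau) auto
  show "realizes (G_mat p q a c) (unit_vec (p + q) 0) (R_mat p q a c) (tau p q a c)"
    using assms(1) by (rule realizes_G_mat)
  show "stable_mat (G_mat p q a c)"
    using assms(3,4) by (auto simp: stable_mat_def eigenvalue_G_mat[OF assms(1)])
  show "controllable (G_mat p q a c) (unit_vec (p + q) 0)"
    using controllable_companion[of "hat_poly p a * hat_poly q c"] assms(1)
    by (simp add: G_mat_eq_companion degree_hat_mult)
  assume "a p \<noteq> 0 \<or> c q \<noteq> 0"
  then show "observable (G_mat p q a c) (R_mat p q a c) \<longleftrightarrow>
      \<not> (\<exists>z. cpoly (lag_poly p a) z = 0 \<and> cpoly (lag_poly q c) z = 0)"
    using hat_polys_common_root_iff[of a p c q, OF _ assms(1,2)]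
      not_observable_common_root[OF assms(1), of a _ q c] observable_no_common_root[OF assms(1), of a q c]
    by blast
qed

end
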